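(* Let $d\ge1$, $k\in\mathbb N$, and $f\in C^k([-1,1]^d)\subset L^2(\mu_d)$, with the expansion $$f=\sum_{K\in\mathbb N^d}c_K\,\overline T_K,\qquad c_K=\langle f,\overline T_K\rangle_{L^2(\mu_d)}.$$ Then $$\sum_{K\in\mathbb N^d}\|K\|_2^{2k}\,c_K^2\ \le\ C'_{d,k}\Big(\max_{0\le|\beta|\le k}\|\partial_x^{\beta}f\|_{L^\infty([-1,1]^d)}\Big)^2,$$ where $C'_{d,k}$ is a constant depending only on $d,k$ with $C'_{d,k}\le d^k e^{2k}(k!)^2$.
   Context: $\mathbb N=\{0,1,2,\dots\}$. For a multi-index $\beta\in\mathbb N^d$, $|\beta|=\sum_i\beta_i$; for $K=(k_1,\dots,k_d)\in\mathbb N^d$, $\|K\|_2^2=\sum_i k_i^2$. On $[-1,1]$ let $d\mu(x)=\frac{dx}{\pi\sqrt{1-x^2}}$ (a probability measure), and let $\mu_d=\mu^{\otimes d}$ on $[-1,1]^d$. The normalized Chebyshev polynomials are $\overline T_0\equiv1$ and $\overline T_j(x)=\sqrt2\cos(j\arccos x)$ for $j\ge1$, $x\in[-1,1]$; for $K\in\mathbb N^d$, $\overline T_K(\mathbf x)=\prod_{i=1}^d\overline T_{k_i}(x_i)$. The family $\{\overline T_K\}_{K\in\mathbb N^d}$ is an orthonormal basis of $L^2(\mu_d)$. *)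

theory Defs
  imports "HOL-Probability.Probability"
begin

text \<open>Points of \<open>\<real>\<^sup>d\<close> and multi-indices are extensional functions on \<open>{..<d}\<close>, so that
  \<open>d\<close> is an ordinary variable; products of measures are then \<open>PiM {..<d}\<close>.\<close>

definition cube :: "nat \<Rightarrow> (nat \<Rightarrow> real) set" where
  "cube d = {..<d} \<rightarrow>\<^sub>E {-1..1}"

definition multi_indices :: "nat \<Rightarrow> (nat \<Rightarrow> nat) set" where
  "multi_indices d = {..<d} \<rightarrow>\<^sub>E UNIV"

text \<open>The value of the density at \<open>-1\<close> and \<open>1\<close> (here \<open>0\<close>, by division by zero) is irrelevant.\<close>

definition cheb_measure :: "real measure" where
  "cheb_measure = density (restrict_space lborel {-1..1}) (\<lambda>x. ennreal (1 / (pi * sqrt (1 - x\<^sup>2))))"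

definition cheb_measure_d :: "nat \<Rightarrow> (nat \<Rightarrow> real) measure" where
  "cheb_measure_d d = PiM {..<d} (\<lambda>_. cheb_measure)"

definition lebesgue_cube :: "nat \<Rightarrow> (nat \<Rightarrow> real) measure" where
  "lebesgue_cube d = PiM {..<d} (\<lambda>_. restrict_space lborel {-1..1})"

definition Tbar :: "nat \<Rightarrow> real \<Rightarrow> real" where
  "Tbar j x = (if j = 0 then 1 else sqrt 2 * cos (real j * arccos x))"

definition Tbar_multi :: "nat \<Rightarrow> (nat \<Rightarrow> nat) \<Rightarrow> (nat \<Rightarrow> real) \<Rightarrow> real" where
  "Tbar_multi d K x = (\<Prod>i<d. Tbar (K i) (x i))"

definition cheb_coeff :: "nat \<Rightarrow> ((nat \<Rightarrow> real) \<Rightarrow> real) \<Rightarrow> (nat \<Rightarrow> nat) \<Rightarrow> real" where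
  "cheb_coeff d f K = (\<integral>x. f x * Tbar_multi d K x \<partial>cheb_measure_d d)"

text \<open>Partial derivatives on the closed cube are taken within \<open>[-1,1]\<close>, i.e. they are one-sided on
  the corresponding faces. On a cube the resulting class \<open>C\<^sup>k\<close> is the same as the one obtained by
  asking the interior partial derivatives to extend continuously to the closed cube.\<close>

definition partial_deriv :: "nat \<Rightarrow> ((nat \<Rightarrow> real) \<Rightarrow> real) \<Rightarrow> (nat \<Rightarrow> real) \<Rightarrow> real" where
  "partial_deriv i f x = vector_derivative (\<lambda>t. f (x(i := t))) (at (x i) within {-1..1})"

primrec C_k_on_cube :: "nat \<Rightarrow> nat \<Rightarrow> ((nat \<Rightarrow> real) \<Rightarrow> real) \<Rightarrow> bool" where
  "C_k_on_cube d 0 f \<longleftrightarrow> continuous_on (cube d) f"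
| "C_k_on_cube d (Suc k) f \<longleftrightarrow> continuous_on (cube d) f \<and>
     (\<forall>i<d. (\<forall>x\<in>cube d. (\<lambda>t. f (x(i := t))) differentiable (at (x i) within {-1..1})) \<and>
            C_k_on_cube d k (partial_deriv i f))"

text \<open>The order of differentiation chosen here, \<open>\<partial>\<^sub>0\<close> outermost, is immaterial for \<open>C\<^sup>k\<close> functions
  and \<open>|\<beta>| \<le> k\<close>.\<close>

definition multi_deriv :: "nat \<Rightarrow> (nat \<Rightarrow> nat) \<Rightarrow> ((nat \<Rightarrow> real) \<Rightarrow> real) \<Rightarrow> (nat \<Rightarrow> real) \<Rightarrow> real" where
  "multi_deriv d \<beta> f = foldr (\<lambda>i. partial_deriv i ^^ \<beta> i) [0..<d] f"

text \<open>Only meaningful for measurable, essentially bounded \<open>g\<close>; otherwise the essential supremum is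
  infinite and \<open>real_of_ereal\<close> returns \<open>0\<close>.\<close>

definition Linf_norm :: "nat \<Rightarrow> ((nat \<Rightarrow> real) \<Rightarrow> real) \<Rightarrow> real" where
  "Linf_norm d g = real_of_ereal (esssup (lebesgue_cube d) (\<lambda>x. ereal \<bar>g x\<bar>))"

definition Ck_norm :: "nat \<Rightarrow> nat \<Rightarrow> ((nat \<Rightarrow> real) \<Rightarrow> real) \<Rightarrow> real" where
  "Ck_norm d k f =
     Max ((\<lambda>\<beta>. Linf_norm d (multi_deriv d \<beta> f)) ` {\<beta> \<in> multi_indices d. (\<Sum>i<d. \<beta> i) \<le> k})"

end

theory Submission
  imports Defs
begin

text \<open>
  The substitution \<open>x\<^sub>i = cos \<theta>\<^sub>i\<close> turns the Chebyshev expansion of \<open>f\<close> into a cosine expansion of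
  \<open>g \<theta> = f (cos \<theta>\<^sub>1, \<dots>, cos \<theta>\<^sub>d)\<close>, and the measure into the uniform one
  (\<open>integral_cheb_measure_cos\<close>). For Fourier series, powers of the frequency are derivatives:
  integrating by parts \<open>k\<close> times in the angle \<open>\<theta>\<^sub>i\<close> shows that \<open>K\<^sub>i\<^sup>k c\<^sub>K\<close> is, up to a sign, the
  coefficient of the \<open>k\<close>-th \<open>\<theta>\<^sub>i\<close>-derivative of \<open>g\<close> with respect to the family that has cosines,
  but sines in coordinate \<open>i\<close> if \<open>k\<close> is odd (\<open>power_mult_cheb_coeff\<close>). No boundary terms occur:
  when the trigonometric factor does not vanish at the ends of \<open>[0, \<pi>]\<close>, the odd derivative of
  \<open>g\<close> next to it does.

  The family is orthogonal, so Bessel's inequality bounds the sum of \<open>(K\<^sub>i\<^sup>k c\<^sub>K)\<^sup>2\<close> over \<open>K\<close> by the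
  square of the supremum of that derivative. The derivative is a combination of
  \<open>sin\<^sup>a \<theta>\<^sub>i cos\<^sup>b \<theta>\<^sub>i \<partial>\<^sub>i\<^sup>a\<^sup>+\<^sup>b f\<close> with \<open>a + b \<le> k\<close>, and the absolute values of its coefficients add up
  to at most \<open>k!\<close> (\<open>trig_terms_weight\<close>), because differentiating a product of \<open>j\<close> sines and cosines
  with a function of \<open>cos \<theta>\<^sub>i\<close> gives \<open>j + 1\<close> such products. Finally
  \<open>d (\<Sum> K\<^sub>i\<^sup>2)\<^sup>k \<le> d\<^sup>k \<Sum> K\<^sub>i\<^sup>2\<^sup>k\<close> by convexity, and summing over the \<open>d\<close> coordinates gives the constant
  \<open>d\<^sup>k (k!)\<^sup>2\<close>.

  Since the norm of \<open>f\<close> is built from essential suprema, the pointwise bounds on the derivatives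
  need that a continuous function on the cube never exceeds its essential supremum
  (\<open>abs_le_Linf_norm\<close>).\<close>

section \<open>The substitution \<open>x = cos \<theta>\<close>\<close>

lemma space_cheb_measure [simp]: "space cheb_measure = {-1..1}"
  by (simp add: cheb_measure_def space_restrict_space)

lemma sets_cheb_measure [measurable_cong]:
  "sets cheb_measure = sets (restrict_space borel {-1..1})"
  by (simp add: cheb_measure_def sets_restrict_space)

text \<open>
  The arc \<open>[-\<pi>, 0]\<close> is used instead of \<open>[0, \<pi>]\<close> because there the cosine increases from
  \<open>-1\<close> to \<open>1\<close>, as the substitution rule requires; evenness of the cosine brings the integral
  back to \<open>[0, \<pi>]\<close> in the end.\<close>

lemma cheb_density_cos:
  assumes "- pi < \<theta>" "\<theta> < 0"
  shows "1 / (pi * sqrt (1 - (cos \<theta>)\<^sup>2)) * (- sin \<theta>) = 1 / pi"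
proof -
  have "sin \<theta> < 0" using assms sin_gt_zero[of "-\<theta>"] by simp
  then have "sqrt (1 - (cos \<theta>)\<^sup>2) = - sin \<theta>"
    by (simp add: sin_squared_eq[symmetric])
  with \<open>sin \<theta> < 0\<close> show ?thesis by simp
qed

lemma prob_space_cheb_measure: "prob_space cheb_measure"
proof
  let ?w = "\<lambda>x::real. 1 / (pi * sqrt (1 - x\<^sup>2))"
  have D: "((\<lambda>x. cos x) has_real_derivative - sin x) (at x)" for x :: real
    by (auto intro!: derivative_eq_intros)
  have neg: "- sin x \<ge> 0" if "x \<in> {-pi..0}" for x
    using that sin_ge_zero[of "-x"] by auto
  have "emeasure cheb_measure (space cheb_measure)
      = (\<integral>\<^sup>+x. ennreal (?w x * indicator {cos (-pi)..cos 0} x) \<partial>lborel)"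
    unfolding space_cheb_measure unfolding cheb_measure_def
    by (subst emeasure_density)
       (auto simp: nn_integral_restrict_space sets_restrict_space measurable_restrict_space1
          intro!: nn_integral_cong split: split_indicator)
  also have "\<dots> = (\<integral>\<^sup>+x. ennreal (?w (cos x) * (- sin x) * indicator {-pi..0} x) \<partial>lborel)"
    using nn_integral_substitution[where a="-pi" and b=0 and g=cos and f="?w" and g'="\<lambda>x. - sin x"] D neg
    by (simp add: set_borel_measurable_def continuous_intros
          nn_integral_set_ennreal[symmetric])
  also have "\<dots> = (\<integral>\<^sup>+x. ennreal (1 / pi) * indicator {-pi..0} x \<partial>lborel)"
  proof (rule nn_integral_cong_AE)
    \<comment> \<open>At the two end points the density has the default value \<open>0\<close>.\<close>
    have "AE x in lborel. x \<noteq> -pi \<and> x \<noteq> (0::real)"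
      by (auto intro: AE_conjI AE_lborel_singleton)
    then show "AE x in lborel. ennreal (?w (cos x) * (- sin x) * indicator {-pi..0} x)
        = ennreal (1 / pi) * indicator {-pi..0} x"
    proof eventually_elim
      fix x assume "x \<noteq> -pi \<and> x \<noteq> 0"
      then show "ennreal (?w (cos x) * (- sin x) * indicator {-pi..0} x)
        = ennreal (1 / pi) * indicator {-pi..0} x"
        using cheb_density_cos[of x] by (cases "x \<in> {-pi..0}") auto
    qed
  qed
  also have "\<dots> = 1"
    by (simp add: nn_integral_cmult_indicator ennreal_mult[symmetric])
  finally show "emeasure cheb_measure (space cheb_measure) = 1" .
qed

lemma integrable_cheb_continuous:
  fixes h :: "real \<Rightarrow> real"
  assumes h: "continuous_on {-1..1} h"
  shows "integrable cheb_measure h"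
proof -
  interpret prob_space cheb_measure by (rule prob_space_cheb_measure)
  have "compact (h ` {-1..1})"
    using h compact_Icc by (rule compact_continuous_image)
  then obtain B where "\<And>x. x \<in> {-1..1} \<Longrightarrow> norm (h x) \<le> B"
    by (meson compact_imp_bounded bounded_iff image_eqI)
  moreover have "h \<in> borel_measurable cheb_measure"
    using borel_measurable_continuous_on_restrict[OF h] by measurable
  ultimately show ?thesis
    by (intro integrable_const_bound[of _ B]) (auto intro: AE_I2)
qed

text \<open>
  The image of the uniform distribution on \<open>[0, \<pi>]\<close> under the cosine is the Chebyshev measure.
  All one-dimensional computations are done on the right-hand side, where nothing is singular.\<close>

lemma integral_cheb_measure_cos:
  fixes h :: "real \<Rightarrow> real"
  assumes h: "continuous_on {-1..1} h"
  shows "integral\<^sup>L cheb_measure h = integral {0..pi} (\<lambda>\<theta>. h (cos \<theta>)) / pi"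
proof -
  let ?w = "\<lambda>x::real. 1 / (pi * sqrt (1 - x\<^sup>2))"
  let ?L = "restrict_space lborel {-1..1::real}"
  have D: "((\<lambda>x. cos x) has_real_derivative - sin x) (at x)" for x :: real
    by (auto intro!: derivative_eq_intros)
  have neg: "- sin x \<ge> 0" if "x \<in> {-pi..0}" for x
    using that sin_ge_zero[of "-x"] by auto
  have hm: "h \<in> borel_measurable ?L"
    using borel_measurable_continuous_on_restrict[OF h]
    by (simp add: measurable_def space_restrict_space sets_restrict_space)
  have wm: "?w \<in> borel_measurable ?L"
    by (intro measurable_restrict_space1) simp
  have w0: "AE x in ?L. 0 \<le> ?w x"
    by (intro AE_I2) (auto simp: space_restrict_space abs_square_le_1)
  have int: "integrable ?L (\<lambda>x. ?w x *\<^sub>R h x)"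
    using integrable_cheb_continuous[OF h]
    by (subst integrable_density[symmetric, OF hm wm w0]) (simp add: cheb_measure_def)
  have sint: "set_integrable lborel {cos (-pi)..cos 0} (\<lambda>x. ?w x * h x)"
    using int by (simp add: integrable_restrict_space set_integrable_def)
  have c: "continuous_on {-pi..0} (\<lambda>\<theta>. h (cos \<theta>))"
    by (rule continuous_on_compose2[OF h]) (auto intro!: continuous_intros)
  have "integral\<^sup>L cheb_measure h = (LINT x|?L. ?w x *\<^sub>R h x)"
    unfolding cheb_measure_def by (rule integral_density[OF hm wm w0])
  also have "\<dots> = (LBINT x. ?w x * h x * indicator {cos (-pi)..cos 0} x)"
    by (simp add: integral_restrict_space mult.commute)
  also have "\<dots> = (LBINT x. ?w (cos x) * h (cos x) * (- sin x) * indicator {-pi..0} x)"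
    by (rule integral_substitution(2)[OF sint D _ neg]) (auto intro!: continuous_intros)
  also have "\<dots> = (LBINT x. indicator {-pi..0} x *\<^sub>R (h (cos x) / pi))"
  proof (rule Bochner_Integration.integral_cong_AE)
    show "(\<lambda>x. ?w (cos x) * h (cos x) * (- sin x) * indicator {-pi..0} x)
        \<in> borel_measurable lborel"
    proof -
      have "set_integrable lborel {-pi..0} (\<lambda>x. ?w (cos x) * h (cos x) * (- sin x))"
        by (rule integral_substitution(1)[OF sint D _ neg]) (auto intro!: continuous_intros)
      then show ?thesis
        by (auto simp: set_integrable_def mult.commute dest!: borel_measurable_integrable)
    qed
    show "(\<lambda>x. indicator {-pi..0} x *\<^sub>R (h (cos x) / pi)) \<in> borel_measurable lborel"
      using c by (intro borel_measurable_integrable borel_integrable_compact continuous_intros) auto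
    have "AE x in lborel. x \<noteq> -pi \<and> x \<noteq> (0::real)"
      by (auto intro: AE_conjI AE_lborel_singleton)
    then show "AE x in lborel. ?w (cos x) * h (cos x) * (- sin x) * indicator {-pi..0} x
        = indicator {-pi..0} x *\<^sub>R (h (cos x) / pi)"
    proof eventually_elim
      fix x assume x: "x \<noteq> -pi \<and> x \<noteq> 0"
      have *: "?w (cos x) * h (cos x) * (- sin x) = h (cos x) * (?w (cos x) * (- sin x))"
        by (simp add: mult_ac)
      show "?w (cos x) * h (cos x) * (- sin x) * indicator {-pi..0} x
        = indicator {-pi..0} x *\<^sub>R (h (cos x) / pi)"
      proof (cases "x \<in> {-pi..0}")
        case True
        then show ?thesis using x cheb_density_cos[of x] unfolding * by simp
      qed simp
    qed
  qed
  also have "\<dots> = integral {-pi..0} (\<lambda>\<theta>. h (cos \<theta>) / pi)"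
    using set_borel_integral_eq_integral(2)[OF borel_integrable_atLeastAtMost',
        of "-pi" 0 "\<lambda>\<theta>. h (cos \<theta>) / pi"] c
    by (simp add: set_lebesgue_integral_def continuous_intros)
  also have "\<dots> = integral {0..pi} (\<lambda>\<theta>. h (cos \<theta>) / pi)"
    using Henstock_Kurzweil_Integration.integral_reflect_real[of pi 0 "\<lambda>\<theta>. h (cos \<theta>) / pi"] by simp
  finally show ?thesis by simp
qed

section \<open>Two orthogonal systems on the interval\<close>

text \<open>
  The frequency is an integer so that the product-to-sum formulas can be used with the
  difference of two indices.\<close>

lemma has_integral_cos_mult:
  "((\<lambda>\<theta>. cos (of_int m * \<theta>)) has_integral (if m = 0 then pi else 0)) {0..pi}"
proof (cases "m = 0")
  case True
  then show ?thesis using has_integral_const_real[of "1::real" 0 pi] by simp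
next
  case False
  have "((\<lambda>\<theta>. cos (of_int m * \<theta>)) has_integral
      (sin (of_int m * pi) / of_int m - sin (of_int m * 0) / of_int m)) {0..pi}"
    using False
    by (intro fundamental_theorem_of_calculus)
       (auto intro!: derivative_eq_intros simp flip: has_real_derivative_iff_has_vector_derivative)
  moreover have "sin (of_int m * pi) = 0"
    by (auto simp: sin_zero_iff_int2)
  ultimately show ?thesis using False by simp
qed

lemma integral_cos_cos:
  "integral {0..pi} (\<lambda>\<theta>. cos (real m * \<theta>) * cos (real n * \<theta>))
    = (if m = n then if m = 0 then pi else pi / 2 else 0)"
proof -
  have "((\<lambda>\<theta>. (cos (of_int (int m - int n) * \<theta>) + cos (of_int (int m + int n) * \<theta>)) / 2) has_integral
      ((if int m - int n = 0 then pi else 0) + (if int m + int n = 0 then pi else 0)) / 2) {0..pi}"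
    by (intro has_integral_divide has_integral_add has_integral_cos_mult)
  also have "(\<lambda>\<theta>. (cos (of_int (int m - int n) * \<theta>) + cos (of_int (int m + int n) * \<theta>)) / 2)
      = (\<lambda>\<theta>. cos (real m * \<theta>) * cos (real n * \<theta>))"
    by (simp add: cos_times_cos algebra_simps)
  finally show ?thesis by (auto dest: integral_unique)
qed

lemma integral_sin_sin:
  "integral {0..pi} (\<lambda>\<theta>. sin (real m * \<theta>) * sin (real n * \<theta>))
    = (if m = n \<and> m \<noteq> 0 then pi / 2 else 0)"
proof -
  have "((\<lambda>\<theta>. (cos (of_int (int m - int n) * \<theta>) - cos (of_int (int m + int n) * \<theta>)) / 2) has_integral
      ((if int m - int n = 0 then pi else 0) - (if int m + int n = 0 then pi else 0)) / 2) {0..pi}"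
    by (intro has_integral_divide has_integral_diff has_integral_cos_mult)
  also have "(\<lambda>\<theta>. (cos (of_int (int m - int n) * \<theta>) - cos (of_int (int m + int n) * \<theta>)) / 2)
      = (\<lambda>\<theta>. sin (real m * \<theta>) * sin (real n * \<theta>))"
    by (simp add: sin_times_sin algebra_simps)
  finally show ?thesis by (auto dest: integral_unique)
qed

text \<open>
  In the variable \<open>\<theta> = arccos x\<close> the functions \<open>Tbar j\<close> are normalized cosines. Differentiating
  a cosine series in \<open>\<theta>\<close> gives a sine series, so the normalized sines are needed as a second
  system. The index \<open>0\<close> gives the zero function, not a unit vector.\<close>

definition Sbar :: "nat \<Rightarrow> real \<Rightarrow> real" where
  "Sbar j x = sqrt 2 * sin (real j * arccos x)"

lemma continuous_on_Tbar [continuous_intros]: "continuous_on {-1..1} (Tbar j)"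
  unfolding Tbar_def by (cases "j = 0") (auto intro!: continuous_intros)

lemma continuous_on_Sbar [continuous_intros]: "continuous_on {-1..1} (Sbar j)"
  unfolding Sbar_def by (auto intro!: continuous_intros)

lemma Tbar_cos: "\<theta> \<in> {0..pi} \<Longrightarrow> Tbar j (cos \<theta>) = (if j = 0 then 1 else sqrt 2) * cos (real j * \<theta>)"
  by (simp add: Tbar_def arccos_cos)

lemma Sbar_cos: "\<theta> \<in> {0..pi} \<Longrightarrow> Sbar j (cos \<theta>) = sqrt 2 * sin (real j * \<theta>)"
  by (simp add: Sbar_def arccos_cos)

lemma integral_Tbar_Tbar:
  "(\<integral>x. Tbar m x * Tbar n x \<partial>cheb_measure) = (if m = n then 1 else 0)"
proof -
  let ?c = "\<lambda>j::nat. if j = 0 then 1 else sqrt 2"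
  have "(\<integral>x. Tbar m x * Tbar n x \<partial>cheb_measure)
      = integral {0..pi} (\<lambda>\<theta>. Tbar m (cos \<theta>) * Tbar n (cos \<theta>)) / pi"
    by (intro integral_cheb_measure_cos continuous_intros)
  also have "integral {0..pi} (\<lambda>\<theta>. Tbar m (cos \<theta>) * Tbar n (cos \<theta>))
      = integral {0..pi} (\<lambda>\<theta>. (?c m * ?c n) * (cos (real m * \<theta>) * cos (real n * \<theta>)))"
    by (intro integral_cong) (simp add: Tbar_cos)
  also have "\<dots> = (if m = n then pi else 0)"
    by (simp add: integral_cos_cos)
  finally show ?thesis by simp
qed

lemma integral_Sbar_Sbar:
  "(\<integral>x. Sbar m x * Sbar n x \<partial>cheb_measure) = (if m = n \<and> m \<noteq> 0 then 1 else 0)"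
proof -
  have "(\<integral>x. Sbar m x * Sbar n x \<partial>cheb_measure)
      = integral {0..pi} (\<lambda>\<theta>. Sbar m (cos \<theta>) * Sbar n (cos \<theta>)) / pi"
    by (intro integral_cheb_measure_cos continuous_intros)
  also have "integral {0..pi} (\<lambda>\<theta>. Sbar m (cos \<theta>) * Sbar n (cos \<theta>))
      = integral {0..pi} (\<lambda>\<theta>. 2 * (sin (real m * \<theta>) * sin (real n * \<theta>)))"
    by (intro integral_cong) (simp add: Sbar_cos)
  also have "\<dots> = (if m = n \<and> m \<noteq> 0 then pi else 0)"
    by (simp add: integral_sin_sin)
  finally show ?thesis by simp
qed

section \<open>Higher derivatives of \<open>H (cos \<theta>)\<close>\<close>

text \<open>
  An entry \<open>(c, a, b)\<close> stands for the function
  \<open>c sin\<^sup>a \<theta> cos\<^sup>b \<theta> H\<^sub>a\<^sub>+\<^sub>b (cos \<theta>)\<close>, where \<open>H\<^sub>j\<close> is the \<open>j\<close>-th derivative of \<open>H\<^sub>0\<close>.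
  By the product and chain rules its derivative is a sum of three functions of the same kind,
  and this is the recursion. That the number of trigonometric factors always equals the order
  of the derivative of \<open>H\<^sub>0\<close> is what makes two exponents enough. When \<open>a\<close> or \<open>b\<close> is \<open>0\<close>, the
  truncated subtraction yields an exponent without meaning, but the coefficient is then \<open>0\<close>.\<close>

primrec trig_terms :: "nat \<Rightarrow> (real \<times> nat \<times> nat) list" where
  "trig_terms 0 = [(1, 0, 0)]"
| "trig_terms (Suc k) = concat (map (\<lambda>(c, a, b).
     [(c * real a, a - 1, b + 1), (- c * real b, a + 1, b - 1), (- c, a + 1, b)]) (trig_terms k))"

definition chain_deriv :: "(nat \<Rightarrow> real \<Rightarrow> real) \<Rightarrow> nat \<Rightarrow> real \<Rightarrow> real" where
  "chain_deriv H k \<theta> =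
     (\<Sum>(c, a, b)\<leftarrow>trig_terms k. c * sin \<theta> ^ a * cos \<theta> ^ b * H (a + b) (cos \<theta>))"

lemma trig_terms_order: "(c, a, b) \<in> set (trig_terms k) \<Longrightarrow> a + b \<le> k"
  by (induction k arbitrary: c a b) fastforce+

text \<open>
  Differentiation exchanges even and odd functions of \<open>\<theta>\<close>. Terms with coefficient \<open>0\<close> have to be
  excluded, since their exponents may come from truncated subtraction.\<close>

lemma trig_terms_parity: "(c, a, b) \<in> set (trig_terms k) \<Longrightarrow> c \<noteq> 0 \<Longrightarrow> even a \<longleftrightarrow> even k"
proof (induction k arbitrary: c a b)
  case (Suc k)
  from Suc.prems(1) obtain t where "t \<in> set (trig_terms k)"
    and "(c, a, b) \<in> set (case t of (c, a, b) \<Rightarrow>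
      [(c * real a, a - 1, b + 1), (- c * real b, a + 1, b - 1), (- c, a + 1, b)])"
    by auto
  moreover obtain c' a' b' where "t = (c', a', b')"
    by (cases t)
  ultimately have t: "(c', a', b') \<in> set (trig_terms k)"
    and eq: "(c, a, b) \<in> {(c' * real a', a' - 1, b' + 1), (- c' * real b', a' + 1, b' - 1), (- c', a' + 1, b')}"
    by simp_all
  from eq \<open>c \<noteq> 0\<close> have "c' \<noteq> 0" "a = a' + 1 \<or> a' = a + 1"
    by auto
  with Suc.IH[OF t] show ?case by auto
qed simp

lemma sum_list_map_concat:
  "sum_list (map g (concat (map h xs))) = (\<Sum>x\<leftarrow>xs. sum_list (map g (h x)))"
  by (induction xs) auto

text \<open>
  Differentiating a term \<open>(c, a, b)\<close> produces terms of total weight \<open>\<bar>c\<bar> (a + b + 1)\<close>, and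
  \<open>a + b \<le> k\<close> after \<open>k\<close> steps; so the total weight grows at most by the factor \<open>k + 1\<close>. This is
  where the \<open>k!\<close> of the final constant comes from.\<close>

lemma trig_terms_weight: "(\<Sum>(c, a, b)\<leftarrow>trig_terms k. \<bar>c\<bar>) \<le> fact k"
proof (induction k)
  case (Suc k)
  have "(\<Sum>(c, a, b)\<leftarrow>trig_terms (Suc k). \<bar>c\<bar>)
      = (\<Sum>(c, a, b)\<leftarrow>trig_terms k. \<bar>c\<bar> * real (a + b + 1))"
    by (simp add: sum_list_map_concat case_prod_beta' abs_mult algebra_simps)
  also have "\<dots> \<le> (\<Sum>(c, a, b)\<leftarrow>trig_terms k. \<bar>c\<bar> * real (Suc k))"
    using trig_terms_order by (intro sum_list_mono) (force intro!: mult_left_mono)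
  also have "\<dots> = (\<Sum>(c, a, b)\<leftarrow>trig_terms k. \<bar>c\<bar>) * real (Suc k)"
    by (simp add: sum_list_mult_const case_prod_beta')
  also have "\<dots> \<le> fact k * real (Suc k)"
    by (intro mult_right_mono Suc.IH) simp
  finally show ?case by (simp only: fact_Suc mult.commute of_nat_mult)
qed simp

lemma abs_chain_deriv_le:
  assumes H: "\<And>j t. j \<le> k \<Longrightarrow> t \<in> {-1..1} \<Longrightarrow> \<bar>H j t\<bar> \<le> M"
  shows "\<bar>chain_deriv H k \<theta>\<bar> \<le> fact k * M"
proof -
  have M: "M \<ge> 0" using H[of 0 0] by simp
  have "\<bar>chain_deriv H k \<theta>\<bar>
      \<le> (\<Sum>(c, a, b)\<leftarrow>trig_terms k. \<bar>c * sin \<theta> ^ a * cos \<theta> ^ b * H (a + b) (cos \<theta>)\<bar>)"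
    unfolding chain_deriv_def using sum_list_abs[of "map _ (trig_terms k)"]
    by (simp add: case_prod_beta' comp_def)
  also have "\<dots> \<le> (\<Sum>(c, a, b)\<leftarrow>trig_terms k. \<bar>c\<bar> * M)"
  proof (intro sum_list_mono, clarify)
    fix c a b assume "(c, a, b) \<in> set (trig_terms k)"
    then have "\<bar>H (a + b) (cos \<theta>)\<bar> \<le> M"
      by (intro H) (auto dest: trig_terms_order)
    moreover have "\<bar>sin \<theta> ^ a\<bar> * \<bar>cos \<theta> ^ b\<bar> \<le> 1 * 1"
      by (intro mult_mono) (auto simp: power_abs power_le_one)
    ultimately have "(\<bar>sin \<theta> ^ a\<bar> * \<bar>cos \<theta> ^ b\<bar>) * \<bar>H (a + b) (cos \<theta>)\<bar> \<le> 1 * M"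
      by (intro mult_mono) auto
    then have "\<bar>c\<bar> * (\<bar>sin \<theta> ^ a\<bar> * \<bar>cos \<theta> ^ b\<bar> * \<bar>H (a + b) (cos \<theta>)\<bar>) \<le> \<bar>c\<bar> * M"
      by (intro mult_left_mono) auto
    then show "\<bar>c * sin \<theta> ^ a * cos \<theta> ^ b * H (a + b) (cos \<theta>)\<bar> \<le> \<bar>c\<bar> * M"
      by (simp add: abs_mult mult_ac)
  qed
  also have "\<dots> = (\<Sum>(c, a, b)\<leftarrow>trig_terms k. \<bar>c\<bar>) * M"
    by (simp add: sum_list_mult_const case_prod_beta')
  also have "\<dots> \<le> fact k * M"
    by (intro mult_right_mono trig_terms_weight M)
  finally show ?thesis .
qed

lemma DERIV_sum_list:
  assumes "\<And>t. t \<in> set ts \<Longrightarrow> (F t has_real_derivative F' t) (at x)"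
  shows "((\<lambda>x. \<Sum>t\<leftarrow>ts. F t x) has_real_derivative (\<Sum>t\<leftarrow>ts. F' t)) (at x)"
  using assms by (induction ts) (auto intro!: DERIV_add)

text \<open>
  The cosine maps the whole line into \<open>[-1, 1]\<close>; hence one-sided derivatives of \<open>H\<close> at the
  end points suffice for two-sided derivatives in \<open>\<theta>\<close> everywhere, and the singularity of
  \<open>arccos\<close> at the end points never appears.\<close>

lemma chain_deriv_has_derivative:
  assumes H: "\<And>j t. j \<le> k \<Longrightarrow> t \<in> {-1..1} \<Longrightarrow>
    (H j has_real_derivative H (Suc j) t) (at t within {-1..1})"
  shows "(chain_deriv H k has_real_derivative chain_deriv H (Suc k) \<theta>) (at \<theta>)"
proof -
  define F' where "F' = (\<lambda>(c, a, b). \<Sum>(c, a, b)\<leftarrow>[(c * real a, a - 1, b + 1),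
    (- c * real b, a + 1, b - 1), (- c, a + 1, b)].
      c * sin \<theta> ^ a * cos \<theta> ^ b * H (a + b) (cos \<theta>))"
  define F where "F = (\<lambda>(c, a, b) \<theta>. c * sin \<theta> ^ a * cos \<theta> ^ b * H (a + b) (cos \<theta>))"
  have "((\<lambda>\<theta>. \<Sum>t\<leftarrow>trig_terms k. F t \<theta>) has_real_derivative (\<Sum>t\<leftarrow>trig_terms k. F' t)) (at \<theta>)"
  proof (rule DERIV_sum_list)
    fix t assume t: "t \<in> set (trig_terms k)"
    obtain c a b where [simp]: "t = (c, a, b)" by (cases t)
    have "(H (a + b) has_real_derivative H (Suc (a + b)) (cos \<theta>)) (at (cos \<theta>) within {-1..1})"
      using t by (intro H) (auto dest: trig_terms_order)
    then have d1: "(H (a + b) has_real_derivative H (Suc (a + b)) (cos \<theta>))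
        (at (cos \<theta>) within range cos)"
      by (rule DERIV_subset) auto
    have d2: "(cos has_real_derivative - sin \<theta>) (at \<theta>)"
      by (auto intro!: derivative_eq_intros)
    have D: "((\<lambda>\<theta>. H (a + b) (cos \<theta>)) has_real_derivative
        H (Suc (a + b)) (cos \<theta>) * - sin \<theta>) (at \<theta>)"
      using DERIV_image_chain[OF d1 d2] by (simp add: comp_def)
    let ?D = "c * (real a * sin \<theta> ^ (a - 1) * cos \<theta>) * cos \<theta> ^ b * H (a + b) (cos \<theta>)
        - c * sin \<theta> ^ a * (real b * cos \<theta> ^ (b - 1) * sin \<theta>) * H (a + b) (cos \<theta>)
        - c * sin \<theta> ^ a * cos \<theta> ^ b * H (Suc (a + b)) (cos \<theta>) * sin \<theta>"
    have "F' t = ?D"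
      unfolding F'_def by (cases a; cases b) (simp_all add: algebra_simps)
    moreover have "((\<lambda>\<theta>. c * sin \<theta> ^ a * cos \<theta> ^ b * H (a + b) (cos \<theta>)) has_real_derivative
        ?D) (at \<theta>)"
      by (rule derivative_eq_intros D refl | simp add: algebra_simps)+
    ultimately show "(F t has_real_derivative F' t) (at \<theta>)"
      unfolding F_def by simp
  qed
  moreover have "(\<lambda>\<theta>. \<Sum>t\<leftarrow>trig_terms k. F t \<theta>) = chain_deriv H k"
    by (simp add: chain_deriv_def F_def case_prod_beta' fun_eq_iff)
  moreover have "(\<Sum>t\<leftarrow>trig_terms k. F' t) = chain_deriv H (Suc k) \<theta>"
    by (simp add: chain_deriv_def F'_def case_prod_beta' sum_list_map_concat)
  ultimately show ?thesis by simp
qed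

lemma continuous_on_chain_deriv:
  assumes H: "\<And>j. j \<le> k \<Longrightarrow> continuous_on {-1..1} (H j)"
  shows "continuous_on A (chain_deriv H k)"
proof -
  have "continuous_on A (\<lambda>\<theta>. \<Sum>(c, a, b)\<leftarrow>ts. c * sin \<theta> ^ a * cos \<theta> ^ b * H (a + b) (cos \<theta>))"
    if "set ts \<subseteq> set (trig_terms k)" for ts
    using that
  proof (induction ts)
    case (Cons t ts)
    obtain c a b where [simp]: "t = (c, a, b)" by (cases t)
    have "continuous_on {-1..1} (H (a + b))"
      using Cons.prems by (intro H) (auto dest: trig_terms_order)
    then have "continuous_on A (\<lambda>\<theta>. H (a + b) (cos \<theta>))"
      by (rule continuous_on_compose2) (auto intro!: continuous_intros)
    with Cons show ?case by (auto intro!: continuous_intros)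
  qed simp
  then show ?thesis unfolding chain_deriv_def by simp
qed

text \<open>
  Every nonzero term of odd order contains the sine to an odd, hence positive, power. These zeros
  remove the boundary terms when a sine coefficient is integrated by parts.\<close>

lemma chain_deriv_odd_vanishes:
  assumes "odd k" "sin \<theta> = 0"
  shows "chain_deriv H k \<theta> = 0"
proof -
  have "(case t of (c, a, b) \<Rightarrow> c * sin \<theta> ^ a * cos \<theta> ^ b * H (a + b) (cos \<theta>)) = 0"
    if t: "t \<in> set (trig_terms k)" for t
  proof -
    obtain c a b where [simp]: "t = (c, a, b)" by (cases t)
    have "c = 0 \<or> 0 < a"
      using trig_terms_parity[of c a b k] t \<open>odd k\<close> by (auto intro: odd_pos)
    then show ?thesis using \<open>sin \<theta> = 0\<close> by auto
  qed
  then have "(\<Sum>t\<leftarrow>trig_terms k. case t of (c, a, b) \<Rightarrow>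
      c * sin \<theta> ^ a * cos \<theta> ^ b * H (a + b) (cos \<theta>)) = (\<Sum>t\<leftarrow>trig_terms k. 0)"
    by (intro arg_cong[of _ _ sum_list] map_cong refl) auto
  then show ?thesis
    unfolding chain_deriv_def by simp
qed

section \<open>Integration by parts\<close>

lemma integral_by_parts_cos:
  assumes G: "\<And>\<theta>. (G has_real_derivative G' \<theta>) (at \<theta>)" and c: "continuous_on {0..pi} G'"
  shows "real n * integral {0..pi} (\<lambda>\<theta>. G \<theta> * cos (real n * \<theta>))
    = - integral {0..pi} (\<lambda>\<theta>. G' \<theta> * sin (real n * \<theta>))"
proof -
  have cG: "continuous_on {0..pi} G"
    using G by (meson DERIV_continuous_on DERIV_subset subset_UNIV)
  have "((\<lambda>\<theta>. G' \<theta> * sin (real n * \<theta>) + real n * (G \<theta> * cos (real n * \<theta>))) has_integral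
      G pi * sin (real n * pi) - G 0 * sin (real n * 0)) {0..pi}"
    by (intro fundamental_theorem_of_calculus)
       (auto intro!: derivative_eq_intros DERIV_subset[OF G]
          simp flip: has_real_derivative_iff_has_vector_derivative)
  then have "0 = integral {0..pi} (\<lambda>\<theta>. G' \<theta> * sin (real n * \<theta>) + real n * (G \<theta> * cos (real n * \<theta>)))"
    by (auto dest: integral_unique)
  also have "\<dots> = integral {0..pi} (\<lambda>\<theta>. G' \<theta> * sin (real n * \<theta>))
      + real n * integral {0..pi} (\<lambda>\<theta>. G \<theta> * cos (real n * \<theta>))"
    using c cG by (subst integral_add)
      (auto intro!: integrable_continuous_interval continuous_intros)
  finally show ?thesis by simp
qed

lemma integral_by_parts_sin:
  assumes G: "\<And>\<theta>. (G has_real_derivative G' \<theta>) (at \<theta>)" and c: "continuous_on {0..pi} G'"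
    and "G 0 = 0" "G pi = 0"
  shows "real n * integral {0..pi} (\<lambda>\<theta>. G \<theta> * sin (real n * \<theta>))
    = integral {0..pi} (\<lambda>\<theta>. G' \<theta> * cos (real n * \<theta>))"
proof -
  have cG: "continuous_on {0..pi} G"
    using G by (meson DERIV_continuous_on DERIV_subset subset_UNIV)
  have "((\<lambda>\<theta>. G' \<theta> * cos (real n * \<theta>) - real n * (G \<theta> * sin (real n * \<theta>))) has_integral
      G pi * cos (real n * pi) - G 0 * cos (real n * 0)) {0..pi}"
    by (intro fundamental_theorem_of_calculus)
       (auto intro!: derivative_eq_intros DERIV_subset[OF G]
          simp flip: has_real_derivative_iff_has_vector_derivative)
  then have "0 = integral {0..pi} (\<lambda>\<theta>. G' \<theta> * cos (real n * \<theta>) - real n * (G \<theta> * sin (real n * \<theta>)))"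
    using assms by (auto dest: integral_unique)
  also have "\<dots> = integral {0..pi} (\<lambda>\<theta>. G' \<theta> * cos (real n * \<theta>))
      - real n * integral {0..pi} (\<lambda>\<theta>. G \<theta> * sin (real n * \<theta>))"
    using c cG by (subst integral_diff)
      (auto intro!: integrable_continuous_interval continuous_intros)
  finally show ?thesis by simp
qed

text \<open>
  The sign collected in \<open>k\<close> integrations by parts that start from a cosine: each passage from
  cosine to sine changes the sign, each passage back keeps it.\<close>

definition trig_sign :: "nat \<Rightarrow> real" where
  "trig_sign k = (-1) ^ ((k + 1) div 2)"

text \<open>
  The system in which the \<open>k\<close>-th \<open>\<theta>\<close>-derivative of a cosine series is expanded.\<close>

definition cheb_system :: "nat \<Rightarrow> nat \<Rightarrow> real \<Rightarrow> real" where
  "cheb_system k = (if even k then Tbar else Sbar)"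

lemma continuous_on_cheb_system [continuous_intros]: "continuous_on {-1..1} (cheb_system k n)"
  by (simp add: cheb_system_def continuous_intros)

lemma integral_cheb_system:
  "(\<integral>x. cheb_system k m x * cheb_system k n x \<partial>cheb_measure) =
     (if m = n \<and> (even k \<or> m \<noteq> 0) then 1 else 0)"
  by (simp add: cheb_system_def integral_Tbar_Tbar integral_Sbar_Sbar)

lemma power_mult_integral_chain_deriv:
  assumes D: "\<And>j t. j < k \<Longrightarrow> t \<in> {-1..1} \<Longrightarrow>
      (H j has_real_derivative H (Suc j) t) (at t within {-1..1})"
    and C: "\<And>j. j \<le> k \<Longrightarrow> continuous_on {-1..1} (H j)"
  shows "real n ^ k * integral {0..pi} (\<lambda>\<theta>. H 0 (cos \<theta>) * cos (real n * \<theta>))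
    = trig_sign k * integral {0..pi} (\<lambda>\<theta>. chain_deriv H k \<theta> *
        (if even k then cos (real n * \<theta>) else sin (real n * \<theta>)))"
  using assms
proof (induction k)
  case 0
  then show ?case by (simp add: chain_deriv_def trig_sign_def)
next
  case (Suc k)
  have der: "\<And>\<theta>. (chain_deriv H k has_real_derivative chain_deriv H (Suc k) \<theta>) (at \<theta>)"
    by (intro chain_deriv_has_derivative Suc.prems) auto
  have con: "continuous_on {0..pi} (chain_deriv H (Suc k))"
    by (intro continuous_on_chain_deriv Suc.prems)
  have "real n ^ Suc k * integral {0..pi} (\<lambda>\<theta>. H 0 (cos \<theta>) * cos (real n * \<theta>))
      = trig_sign k * (real n * integral {0..pi} (\<lambda>\<theta>. chain_deriv H k \<theta> *
        (if even k then cos (real n * \<theta>) else sin (real n * \<theta>))))"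
    using Suc.IH Suc.prems by (simp add: mult_ac)
  also have "\<dots> = trig_sign (Suc k) * integral {0..pi} (\<lambda>\<theta>. chain_deriv H (Suc k) \<theta> *
        (if even (Suc k) then cos (real n * \<theta>) else sin (real n * \<theta>)))"
  proof (cases "even k")
    case True
    then have "trig_sign (Suc k) = - trig_sign k"
      by (auto simp: trig_sign_def elim!: evenE)
    with True integral_by_parts_cos[OF der con, of n] show ?thesis by simp
  next
    case False
    then have "trig_sign (Suc k) = trig_sign k"
      by (auto simp: trig_sign_def elim!: oddE)
    with False integral_by_parts_sin[OF der con, of n] show ?thesis
      by (simp add: chain_deriv_odd_vanishes)
  qed
  finally show ?case .
qed

text \<open>
  A \<open>k\<close>-fold integration by parts in \<open>\<theta>\<close>, written in the variable \<open>x = cos \<theta>\<close>. The identity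
  includes \<open>n = 0\<close>, although \<open>Tbar 0\<close> has another normalization than the cosine and sine systems
  have otherwise: for odd \<open>k\<close> the sine vanishes, and for even \<open>k\<close> the factor is the same on both sides.\<close>

lemma power_mult_integral_Tbar:
  assumes D: "\<And>j t. j < k \<Longrightarrow> t \<in> {-1..1} \<Longrightarrow>
      (H j has_real_derivative H (Suc j) t) (at t within {-1..1})"
    and C: "\<And>j. j \<le> k \<Longrightarrow> continuous_on {-1..1} (H j)"
  shows "real n ^ k * (\<integral>x. H 0 x * Tbar n x \<partial>cheb_measure)
    = trig_sign k * (\<integral>x. chain_deriv H k (arccos x) * cheb_system k n x \<partial>cheb_measure)"
proof -
  let ?c = "if n = 0 then 1 else sqrt 2"
  let ?t = "\<lambda>\<theta>. if even k then cos (real n * \<theta>) else sin (real n * \<theta>)"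
  have "(\<integral>x. H 0 x * Tbar n x \<partial>cheb_measure)
      = integral {0..pi} (\<lambda>\<theta>. H 0 (cos \<theta>) * Tbar n (cos \<theta>)) / pi"
    by (intro integral_cheb_measure_cos continuous_intros C) simp
  also have "integral {0..pi} (\<lambda>\<theta>. H 0 (cos \<theta>) * Tbar n (cos \<theta>))
      = integral {0..pi} (\<lambda>\<theta>. ?c * (H 0 (cos \<theta>) * cos (real n * \<theta>)))"
    by (intro integral_cong) (simp add: Tbar_cos)
  finally have 1: "(\<integral>x. H 0 x * Tbar n x \<partial>cheb_measure)
      = ?c / pi * integral {0..pi} (\<lambda>\<theta>. H 0 (cos \<theta>) * cos (real n * \<theta>))"
    by simp
  have "(\<integral>x. chain_deriv H k (arccos x) * cheb_system k n x \<partial>cheb_measure)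
      = integral {0..pi} (\<lambda>\<theta>. chain_deriv H k (arccos (cos \<theta>)) * cheb_system k n (cos \<theta>)) / pi"
    by (intro integral_cheb_measure_cos continuous_intros
          continuous_on_compose2[OF continuous_on_chain_deriv[of k H UNIV]] C) auto
  also have "integral {0..pi} (\<lambda>\<theta>. chain_deriv H k (arccos (cos \<theta>)) * cheb_system k n (cos \<theta>))
      = integral {0..pi} (\<lambda>\<theta>. ?c * (chain_deriv H k \<theta> * ?t \<theta>))"
    by (intro integral_cong) (simp add: Tbar_cos Sbar_cos cheb_system_def arccos_cos)
  finally have 2: "(\<integral>x. chain_deriv H k (arccos x) * cheb_system k n x \<partial>cheb_measure)
      = ?c / pi * integral {0..pi} (\<lambda>\<theta>. chain_deriv H k \<theta> * ?t \<theta>)"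
    by simp
  have "real n ^ k * integral {0..pi} (\<lambda>\<theta>. H 0 (cos \<theta>) * cos (real n * \<theta>))
      = trig_sign k * integral {0..pi} (\<lambda>\<theta>. chain_deriv H k \<theta> * ?t \<theta>)"
    by (rule power_mult_integral_chain_deriv[where H = H and k = k]) (fact D C)+
  then show ?thesis unfolding 1 2 mult.left_commute[of _ "?c / pi"] by (rule arg_cong)
qed

section \<open>Continuous functions on the cube\<close>

text \<open>
  The topology on \<open>nat \<Rightarrow> real\<close> is the product over all indices. As points of the cube take a fixed
  value outside \<open>{..<d}\<close>, the cube is itself a full product there, with one-point factors.\<close>

lemma cube_eq_PiE_UNIV: "cube d = Pi\<^sub>E UNIV (\<lambda>i. if i < d then {-1..1} else {undefined})"
  by (auto simp: cube_def PiE_def Pi_def extensional_def split: if_splits)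

lemma compact_cube: "compact (cube d)"
proof -
  have "compactin (product_topology (\<lambda>i. euclidean) UNIV) (cube d)"
    unfolding cube_eq_PiE_UNIV compactin_PiE by simp
  then show ?thesis by (simp add: euclidean_product_topology)
qed

lemma cube_coord: "x \<in> cube d \<Longrightarrow> i < d \<Longrightarrow> x i \<in> {-1..1}"
  unfolding cube_def by (drule PiE_mem[where x = i]) simp_all

lemma cube_upd: "x \<in> cube d \<Longrightarrow> i < d \<Longrightarrow> t \<in> {-1..1} \<Longrightarrow> x(i := t) \<in> cube d"
  by (auto simp: cube_def PiE_def Pi_def extensional_def)

lemma continuous_on_coord: "continuous_on S (\<lambda>x. x i :: real)"
  by (rule continuous_on_subset[OF continuous_on_product_coordinates]) simp

lemma continuous_on_cube_coord:
  fixes g :: "real \<Rightarrow> real"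
  assumes "continuous_on {-1..1} g" "i < d"
  shows "continuous_on (cube d) (\<lambda>x. g (x i))"
  by (rule continuous_on_compose2[OF assms(1) continuous_on_coord])
     (use assms(2) cube_coord in blast)

lemma bounded_on_cube:
  fixes g :: "_ \<Rightarrow> real"
  assumes "continuous_on (cube d) g"
  obtains B where "\<And>x. x \<in> cube d \<Longrightarrow> \<bar>g x\<bar> \<le> B"
proof -
  have "compact (g ` cube d)"
    using assms compact_cube by (rule compact_continuous_image)
  then obtain B where "\<forall>y\<in>g ` cube d. norm y \<le> B"
    by (meson compact_imp_bounded bounded_iff)
  then show ?thesis by (intro that[of B]) auto
qed

text \<open>
  Measurability on \<open>PiM {..<d}\<close> is obtained by viewing points of the cube as elements of
  \<open>nat \<Rightarrow> real\<close>, whose Borel sets are generated by the countably many coordinates.\<close>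

lemma measurable_continuous_on_cube:
  fixes g :: "_ \<Rightarrow> real"
  assumes N: "sets N = sets (restrict_space borel {-1..1::real})"
    and g: "continuous_on (cube d) g"
  shows "g \<in> borel_measurable (PiM {..<d} (\<lambda>_. N))"
proof -
  let ?P = "PiM {..<d} (\<lambda>_. N)"
  have sp: "space N = {-1..1}"
    using sets_eq_imp_space_eq[OF N] by (simp add: space_restrict_space)
  have "(\<lambda>x. x i) \<in> borel_measurable ?P" for i
  proof (cases "i < d")
    case True
    have "(\<lambda>t. t) \<in> borel_measurable N"
      using measurable_restrict_space1[OF measurable_ident, of borel "{-1..1::real}"]
      by (simp add: measurable_cong_sets[OF N refl] id_def)
    with True show ?thesis
      by (intro measurable_compose[OF measurable_component_singleton[of i]]) auto
  next
    case False
    have "(\<lambda>x. undefined :: real) \<in> borel_measurable ?P"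
      by simp
    then show ?thesis
      by (rule measurable_cong[THEN iffD1, rotated])
         (use False in \<open>auto simp: space_PiM PiE_def extensional_def\<close>)
  qed
  then have "(\<lambda>x. x) \<in> measurable ?P borel"
    by (intro measurable_coordinatewise_then_product) auto
  then have "(\<lambda>x. x) \<in> measurable ?P (restrict_space borel (cube d))"
    by (intro measurable_restrict_space2) (auto simp: space_PiM cube_def sp)
  from measurable_compose[OF this borel_measurable_continuous_on_restrict[OF g]]
  show ?thesis .
qed

lemma product_sigma_finite_cheb: "product_sigma_finite (\<lambda>_::nat. cheb_measure)"
proof -
  interpret prob_space cheb_measure by (rule prob_space_cheb_measure)
  show ?thesis by unfold_locales
qed

lemma prob_space_cheb_measure_d: "prob_space (cheb_measure_d d)"
  unfolding cheb_measure_d_def by (intro prob_space_PiM prob_space_cheb_measure)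

lemma space_cheb_measure_d [simp]: "space (cheb_measure_d d) = cube d"
  by (simp add: cheb_measure_d_def cube_def space_PiM)

lemma integrable_continuous_on_cube:
  fixes g :: "_ \<Rightarrow> real"
  assumes g: "continuous_on (cube d) g"
  shows "integrable (cheb_measure_d d) g"
proof -
  interpret prob_space "cheb_measure_d d" by (rule prob_space_cheb_measure_d)
  obtain B where "\<And>x. x \<in> cube d \<Longrightarrow> \<bar>g x\<bar> \<le> B"
    using bounded_on_cube[OF g] by blast
  moreover have "g \<in> borel_measurable (cheb_measure_d d)"
    unfolding cheb_measure_d_def by (rule measurable_continuous_on_cube[OF sets_cheb_measure g])
  ultimately show ?thesis
    by (intro integrable_const_bound[of _ B]) (auto intro: AE_I2)
qed

section \<open>Suprema of partial derivatives\<close>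

lemma emeasure_open_Int_Icc_pos:
  fixes U :: "real set"
  assumes "open U" "t \<in> U" "t \<in> {-1..1}"
  shows "emeasure (restrict_space lborel {-1..1}) (U \<inter> {-1..1}) \<noteq> 0"
proof
  assume 0: "emeasure (restrict_space lborel {-1..1}) (U \<inter> {-1..1}) = 0"
  have "U \<inter> closure {-1<..<1} \<noteq> {}"
    using assms by auto
  then have ne: "U \<inter> {-1<..<1} \<noteq> {}"
    by (subst (asm) open_Int_closure_eq_empty[OF assms(1)])
  have "emeasure lborel (U \<inter> {-1<..<1}) \<le> emeasure lborel (U \<inter> {-1..1})"
    using assms(1) by (intro emeasure_mono) auto
  also have "\<dots> = 0"
    using 0 assms(1) by (subst (asm) emeasure_restrict_space) (auto simp: Int_commute)
  finally have "negligible (U \<inter> {-1<..<1})"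
    using assms(1) by (simp add: negligible_iff_emeasure0)
  moreover have "open (U \<inter> {-1<..<1})"
    using assms(1) by auto
  ultimately show False
    using open_not_negligible ne by blast
qed

text \<open>
  A nonempty relatively open subset of the cube contains a relatively open box, and each side of
  the box has positive length, also when the box touches the boundary of the cube.\<close>

lemma emeasure_lebesgue_cube_open_pos:
  assumes U: "open U" "x \<in> U" "x \<in> cube d"
    and S: "U \<inter> cube d \<subseteq> S" "S \<in> sets (lebesgue_cube d)"
  shows "emeasure (lebesgue_cube d) S \<noteq> 0"
proof -
  let ?L = "restrict_space lborel {-1..1::real}"
  interpret L: sigma_finite_measure ?L
    by (intro sigma_finite_measure_restrict_space sigma_finite_lborel) auto
  interpret product_sigma_finite "\<lambda>_::nat. ?L"
    by unfold_locales
  obtain X where X: "x \<in> Pi\<^sub>E UNIV X" "\<And>i. open (X i)" "Pi\<^sub>E UNIV X \<subseteq> U"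
    using product_topology_open_contains_basis[of "\<lambda>_. euclidean" UNIV U x] U
    by (auto simp: euclidean_product_topology)
  have meas: "X i \<inter> {-1..1} \<in> sets ?L" for i
    using X(2)[of i] by (auto simp: sets_restrict_space)
  have "(\<Prod>i<d. emeasure ?L (X i \<inter> {-1..1})) \<noteq> 0"
  proof -
    have "emeasure ?L (X i \<inter> {-1..1}) \<noteq> 0" if "i < d" for i
      using X(1) by (intro emeasure_open_Int_Icc_pos[OF X(2) _ cube_coord[OF U(3) that]]) auto
    then show ?thesis by simp
  qed
  then have "emeasure (lebesgue_cube d) (Pi\<^sub>E {..<d} (\<lambda>i. X i \<inter> {-1..1})) \<noteq> 0"
    unfolding lebesgue_cube_def using meas by (subst emeasure_PiM) auto
  moreover have "Pi\<^sub>E {..<d} (\<lambda>i. X i \<inter> {-1..1}) \<subseteq> S"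
  proof
    fix y assume y: "y \<in> Pi\<^sub>E {..<d} (\<lambda>i. X i \<inter> {-1..1})"
    have "y i \<in> X i" for i
    proof (cases "i < d")
      case False
      then have "y i = x i"
        using y U(3) by (auto simp: cube_def PiE_def extensional_def)
      then show ?thesis using X(1) by auto
    qed (use y in auto)
    moreover have "y \<in> cube d"
      using y by (auto simp: cube_def PiE_def)
    ultimately show "y \<in> S"
      using X(3) S(1) by (auto simp: PiE_def)
  qed
  ultimately show ?thesis
    using emeasure_mono[OF _ S(2), of "Pi\<^sub>E {..<d} (\<lambda>i. X i \<inter> {-1..1})"] by auto
qed

text \<open>
  A continuous function that exceeded its essential supremum at one point would exceed it on a
  relatively open set, which has positive measure. Boundedness on the compact cube makes the
  essential supremum finite, so that passing from \<open>ereal\<close> to \<open>real\<close> loses nothing.\<close>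

lemma abs_le_Linf_norm:
  assumes g: "continuous_on (cube d) g" and x: "x \<in> cube d"
  shows "\<bar>g x\<bar> \<le> Linf_norm d g"
proof -
  let ?E = "esssup (lebesgue_cube d) (\<lambda>x. ereal \<bar>g x\<bar>)"
  have sp: "space (lebesgue_cube d) = cube d"
    by (simp add: lebesgue_cube_def cube_def space_PiM space_restrict_space)
  have gm: "g \<in> borel_measurable (lebesgue_cube d)"
    unfolding lebesgue_cube_def
    by (rule measurable_continuous_on_cube[OF _ g]) (simp add: sets_restrict_space)
  then have m [measurable]: "(\<lambda>x. ereal \<bar>g x\<bar>) \<in> borel_measurable (lebesgue_cube d)"
    by measurable
  obtain B where B: "\<And>x. x \<in> cube d \<Longrightarrow> \<bar>g x\<bar> \<le> B"
    using bounded_on_cube[OF g] by blast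
  have "?E \<le> ereal B"
    by (rule esssup_I[OF m]) (auto intro!: AE_I2 B simp: sp)
  moreover have le: "ereal \<bar>g x\<bar> \<le> ?E"
  proof (rule ccontr)
    assume "\<not> ereal \<bar>g x\<bar> \<le> ?E"
    \<comment> \<open>A real \<open>r\<close> in between makes the set where \<open>\<bar>g\<bar>\<close> exceeds it relatively open.\<close>
    then obtain r where r: "?E < ereal r" "r < \<bar>g x\<bar>"
      using ereal_dense2[of ?E "ereal \<bar>g x\<bar>"] by (auto simp: not_le)
    have "continuous_on (cube d) (\<lambda>x. \<bar>g x\<bar>)"
      using g by (intro continuous_intros)
    then obtain U where U: "open U" "U \<inter> cube d = (\<lambda>x. \<bar>g x\<bar>) -` {r<..} \<inter> cube d"
      by (metis continuous_on_open_invariant open_greaterThan)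
    have "emeasure (lebesgue_cube d) {x \<in> space (lebesgue_cube d). ereal \<bar>g x\<bar> > ?E} \<noteq> 0"
    proof (rule emeasure_lebesgue_cube_open_pos[OF U(1) _ x])
      show "x \<in> U" using U(2) x r(2) by auto
      show "U \<inter> cube d \<subseteq> {x \<in> space (lebesgue_cube d). ereal \<bar>g x\<bar> > ?E}"
        unfolding U(2) using r(1) by (auto simp: sp intro: less_trans)
    qed measurable
    then show False by (simp add: esssup_zero_measure)
  qed
  ultimately obtain e where "?E = ereal e"
    by (cases ?E) auto
  with le show ?thesis
    by (simp add: Linf_norm_def)
qed

text \<open>
  The pure derivatives \<open>\<partial>\<^sub>i\<^sup>j f\<close> are among those over which \<open>Ck_norm\<close> takes the maximum.\<close>

lemma multi_deriv_single:
  assumes "i < d"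
  shows "multi_deriv d (\<lambda>l\<in>{..<d}. if l = i then j else 0) f = (partial_deriv i ^^ j) f"
proof -
  have "foldr (\<lambda>l. partial_deriv l ^^ (\<lambda>l\<in>{..<d}. if l = i then j else 0) l) ls f
      = (if i \<in> set ls then (partial_deriv i ^^ j) f else f)"
    if "distinct ls" "set ls \<subseteq> {..<d}" for ls
    using that by (induction ls) auto
  from this[of "[0..<d]"] assms show ?thesis
    by (simp add: multi_deriv_def lessThan_atLeast0)
qed

lemma C_k_partial_deriv:
  assumes "C_k_on_cube d k f" "i < d" "j \<le> k"
  shows "C_k_on_cube d (k - j) ((partial_deriv i ^^ j) f)"
  using \<open>j \<le> k\<close>
proof (induction j)
  case (Suc j)
  then have "C_k_on_cube d (Suc (k - Suc j)) ((partial_deriv i ^^ j) f)"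
    by (simp add: Suc_diff_Suc)
  with \<open>i < d\<close> show ?case by simp
qed (use assms in simp)

lemma C_k_imp_continuous: "C_k_on_cube d k f \<Longrightarrow> continuous_on (cube d) f"
  by (cases k) auto

lemma C_k_partial_deriv_continuous:
  assumes "C_k_on_cube d k f" "i < d" "j \<le> k"
  shows "continuous_on (cube d) ((partial_deriv i ^^ j) f)"
  using C_k_partial_deriv[OF assms] by (rule C_k_imp_continuous)

lemma C_k_has_partial_deriv:
  assumes "C_k_on_cube d k f" "i < d" "j < k" "x \<in> cube d" "t \<in> {-1..1}"
  shows "((\<lambda>t. (partial_deriv i ^^ j) f (x(i := t))) has_real_derivative
    (partial_deriv i ^^ Suc j) f (x(i := t))) (at t within {-1..1})"
proof -
  let ?g = "(partial_deriv i ^^ j) f"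
  have "C_k_on_cube d (Suc (k - Suc j)) ?g"
    using C_k_partial_deriv[of d k f i j] assms by (simp add: Suc_diff_Suc)
  moreover have "x(i := t) \<in> cube d"
    using assms by (simp add: cube_upd)
  ultimately have "(\<lambda>s. ?g ((x(i := t))(i := s))) differentiable (at ((x(i := t)) i) within {-1..1})"
    using \<open>i < d\<close> by (simp only: C_k_on_cube.simps)
  then have "(\<lambda>s. ?g (x(i := s))) differentiable (at t within {-1..1})"
    by simp
  then show ?thesis
    by (simp add: vector_derivative_works has_real_derivative_iff_has_vector_derivative partial_deriv_def)
qed

lemma abs_partial_deriv_le_Ck_norm:
  assumes "C_k_on_cube d k f" "i < d" "j \<le> k" "x \<in> cube d"
  shows "\<bar>(partial_deriv i ^^ j) f x\<bar> \<le> Ck_norm d k f"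
proof -
  let ?B = "{\<beta> \<in> multi_indices d. (\<Sum>i<d. \<beta> i) \<le> k}"
  let ?\<beta> = "\<lambda>l\<in>{..<d}. if l = i then j else 0"
  \<comment> \<open>Finiteness gives \<open>Max\<close> its meaning.\<close>
  have "?B \<subseteq> Pi\<^sub>E {..<d} (\<lambda>_. {..k})"
    by (auto simp: multi_indices_def PiE_def Pi_def intro: order_trans[OF member_le_sum])
  then have "finite ?B"
    by (rule finite_subset) (simp add: finite_PiE)
  moreover have "?\<beta> \<in> ?B"
    using assms by (auto simp: multi_indices_def)
  ultimately have "Linf_norm d (multi_deriv d ?\<beta> f) \<le> Ck_norm d k f"
    unfolding Ck_norm_def by (intro Max_ge) auto
  moreover have "\<bar>(partial_deriv i ^^ j) f x\<bar> \<le> Linf_norm d ((partial_deriv i ^^ j) f)"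
    using assms by (intro abs_le_Linf_norm C_k_partial_deriv_continuous)
  ultimately show ?thesis
    using multi_deriv_single[OF \<open>i < d\<close>] by simp
qed

section \<open>Bessel's inequality and power means\<close>

text \<open>
  Vectors of norm less than \<open>1\<close> are admitted in the orthogonal family, because the sine system
  contains the zero function.\<close>

lemma bessel_inequality:
  fixes F :: "'a \<Rightarrow> real" and \<phi> :: "'i \<Rightarrow> 'a \<Rightarrow> real"
  assumes A: "finite A"
    and FF: "integrable M (\<lambda>x. F x * F x)"
    and F\<phi>: "\<And>K. K \<in> A \<Longrightarrow> integrable M (\<lambda>x. F x * \<phi> K x)"
    and \<phi>\<phi>: "\<And>K L. K \<in> A \<Longrightarrow> L \<in> A \<Longrightarrow> integrable M (\<lambda>x. \<phi> K x * \<phi> L x)"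
    and orth: "\<And>K L. K \<in> A \<Longrightarrow> L \<in> A \<Longrightarrow> K \<noteq> L \<Longrightarrow> (\<integral>x. \<phi> K x * \<phi> L x \<partial>M) = 0"
    and norm: "\<And>K. K \<in> A \<Longrightarrow> (\<integral>x. \<phi> K x * \<phi> K x \<partial>M) \<le> 1"
  shows "(\<Sum>K\<in>A. (\<integral>x. F x * \<phi> K x \<partial>M)\<^sup>2) \<le> (\<integral>x. F x * F x \<partial>M)"
proof -
  define a where "a K = (\<integral>x. F x * \<phi> K x \<partial>M)" for K
  have "0 \<le> (\<integral>x. (F x - (\<Sum>K\<in>A. a K * \<phi> K x))\<^sup>2 \<partial>M)"
    by (intro Bochner_Integration.integral_nonneg) simp
  also have "\<dots> = (\<integral>x. F x * F x - 2 * (\<Sum>K\<in>A. a K * (F x * \<phi> K x))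
      + (\<Sum>K\<in>A. \<Sum>L\<in>A. a K * a L * (\<phi> K x * \<phi> L x)) \<partial>M)"
    by (intro Bochner_Integration.integral_cong refl)
       (simp add: power2_eq_square algebra_simps sum_product sum_distrib_left sum_distrib_right)
  also have "\<dots> = (\<integral>x. F x * F x \<partial>M) - 2 * (\<Sum>K\<in>A. a K * a K)
      + (\<Sum>K\<in>A. \<Sum>L\<in>A. a K * a L * (\<integral>x. \<phi> K x * \<phi> L x \<partial>M))"
    using FF F\<phi> \<phi>\<phi> by (simp add: a_def)
  also have "(\<Sum>K\<in>A. \<Sum>L\<in>A. a K * a L * (\<integral>x. \<phi> K x * \<phi> L x \<partial>M))
      = (\<Sum>K\<in>A. a K * a K * (\<integral>x. \<phi> K x * \<phi> K x \<partial>M))"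
  proof (intro sum.cong refl)
    fix K assume K: "K \<in> A"
    have "(\<Sum>L\<in>A. a K * a L * (\<integral>x. \<phi> K x * \<phi> L x \<partial>M))
        = (\<Sum>L\<in>A. if L = K then a K * a K * (\<integral>x. \<phi> K x * \<phi> K x \<partial>M) else 0)"
      using K orth by (intro sum.cong) auto
    then show "(\<Sum>L\<in>A. a K * a L * (\<integral>x. \<phi> K x * \<phi> L x \<partial>M))
        = a K * a K * (\<integral>x. \<phi> K x * \<phi> K x \<partial>M)"
      using A K by simp
  qed
  also have "\<dots> \<le> (\<Sum>K\<in>A. a K * a K)"
    using norm by (intro sum_mono mult_left_le) auto
  finally show ?thesis
    by (simp add: a_def power2_eq_square)
qed

text \<open>
  Jensen's inequality for \<open>x \<mapsto> x ^ k\<close> with equal weights. The factor \<open>card I\<close> on the left replaces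
  the usual exponent \<open>k - 1\<close> on the right, so that \<open>k = 0\<close> is covered.\<close>

lemma power_mean_ineq:
  fixes a :: "'i \<Rightarrow> real"
  assumes "finite I" "I \<noteq> {}" "\<And>i. i \<in> I \<Longrightarrow> 0 \<le> a i"
  shows "real (card I) * (\<Sum>i\<in>I. a i) ^ k \<le> real (card I) ^ k * (\<Sum>i\<in>I. a i ^ k)"
proof -
  let ?n = "real (card I)"
  have n: "?n > 0" using assms by (simp add: card_gt_0_iff)
  have "convex_on {0::real..} (\<lambda>x. x ^ k)"
    by (cases "even k") (auto intro: convex_power_odd convex_on_subset[OF convex_power_even])
  then have "(\<Sum>i\<in>I. (1 / ?n) *\<^sub>R a i) ^ k \<le> (\<Sum>i\<in>I. 1 / ?n * a i ^ k)"
    using assms n by (intro convex_on_sum) auto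
  then have "((\<Sum>i\<in>I. a i) / ?n) ^ k \<le> (\<Sum>i\<in>I. a i ^ k) / ?n"
    by (simp add: sum_divide_distrib)
  then show ?thesis
    using n by (simp add: field_simps power_divide)
qed

section \<open>Coefficients in several variables\<close>

text \<open>
  The parity of \<open>m l\<close> selects the cosine or the sine system in coordinate \<open>l\<close>: differentiation in
  one angle changes the system in that coordinate only.\<close>

definition product_system :: "nat \<Rightarrow> (nat \<Rightarrow> nat) \<Rightarrow> (nat \<Rightarrow> nat) \<Rightarrow> (nat \<Rightarrow> real) \<Rightarrow> real" where
  "product_system d m K x = (\<Prod>l<d. cheb_system (m l) (K l) (x l))"

lemma continuous_on_product_system: "continuous_on (cube d) (product_system d m K)"
  unfolding product_system_def
  by (intro continuous_on_prod continuous_on_cube_coord continuous_intros) simp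

lemma Tbar_multi_eq_product_system: "Tbar_multi d = product_system d (\<lambda>_. 0)"
  by (simp add: fun_eq_iff Tbar_multi_def product_system_def cheb_system_def)

lemma integral_product_system:
  "(\<integral>x. product_system d m K x * product_system d m L x \<partial>cheb_measure_d d)
     = (\<Prod>l<d. if K l = L l \<and> (even (m l) \<or> K l \<noteq> 0) then 1 else 0)"
proof -
  interpret product_sigma_finite "\<lambda>_::nat. cheb_measure"
    by (rule product_sigma_finite_cheb)
  have "(\<integral>x. product_system d m K x * product_system d m L x \<partial>cheb_measure_d d)
      = (\<integral>x. (\<Prod>l<d. cheb_system (m l) (K l) (x l) * cheb_system (m l) (L l) (x l)) \<partial>cheb_measure_d d)"
    by (simp add: product_system_def prod.distrib)
  also have "\<dots> = (\<Prod>l<d. \<integral>t. cheb_system (m l) (K l) t * cheb_system (m l) (L l) t \<partial>cheb_measure)"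
    unfolding cheb_measure_d_def
    by (intro product_integral_prod integrable_cheb_continuous continuous_intros) simp
  finally show ?thesis by (simp add: integral_cheb_system)
qed

lemma bessel_product_system:
  assumes F: "continuous_on (cube d) F" and A: "finite A" "A \<subseteq> multi_indices d"
  shows "(\<Sum>K\<in>A. (\<integral>x. F x * product_system d m K x \<partial>cheb_measure_d d)\<^sup>2)
    \<le> (\<integral>x. F x * F x \<partial>cheb_measure_d d)"
proof (rule bessel_inequality[OF A(1)])
  fix K L assume KL: "K \<in> A" "L \<in> A" "K \<noteq> L"
  then obtain l where "l < d" "K l \<noteq> L l"
    using A(2) PiE_ext[of K "{..<d}" "\<lambda>_. UNIV" L] by (auto simp: multi_indices_def)
  then show "(\<integral>x. product_system d m K x * product_system d m L x \<partial>cheb_measure_d d) = 0"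
    unfolding integral_product_system by (intro prod_zero) auto
next
  fix K
  show "(\<integral>x. product_system d m K x * product_system d m K x \<partial>cheb_measure_d d) \<le> 1"
    unfolding integral_product_system by (intro prod_le_1) auto
qed (intro integrable_continuous_on_cube continuous_on_mult F continuous_on_product_system)+

text \<open>
  The \<open>k\<close>-th derivative of \<open>f\<close> with respect to the angle \<open>\<theta>\<^sub>i = arccos x\<^sub>i\<close>.\<close>

definition angular_deriv :: "nat \<Rightarrow> nat \<Rightarrow> ((nat \<Rightarrow> real) \<Rightarrow> real) \<Rightarrow> (nat \<Rightarrow> real) \<Rightarrow> real" where
  "angular_deriv i k f x =
     chain_deriv (\<lambda>j t. (partial_deriv i ^^ j) f (x(i := t))) k (arccos (x i))"

text \<open>
  On the cube the argument \<open>x(i := cos (arccos (x i)))\<close> of the partial derivatives is \<open>x\<close> itself.\<close>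

lemma continuous_on_angular_deriv:
  assumes f: "C_k_on_cube d k f" and i: "i < d"
  shows "continuous_on (cube d) (angular_deriv i k f)"
proof -
  let ?T = "\<lambda>x (c, a, b). c * sin (arccos (x i)) ^ a * x i ^ b * (partial_deriv i ^^ (a + b)) f x"
  have "continuous_on (cube d) (\<lambda>x. \<Sum>t\<leftarrow>ts. ?T x t)" if "set ts \<subseteq> set (trig_terms k)" for ts
    using that
  proof (induction ts)
    case (Cons t ts)
    obtain c a b where [simp]: "t = (c, a, b)" by (cases t)
    have "continuous_on (cube d) ((partial_deriv i ^^ (a + b)) f)"
      using Cons.prems trig_terms_order[of c a b k]
      by (intro C_k_partial_deriv_continuous[OF f i]) auto
    moreover have "continuous_on (cube d) (\<lambda>x. sin (arccos (x i)))"
      using i by (intro continuous_on_cube_coord[where g = "\<lambda>t. sin (arccos t)"] continuous_intros) auto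
    ultimately show ?case
      using Cons by (auto intro!: continuous_intros continuous_on_coord)
  qed simp
  then have "continuous_on (cube d) (\<lambda>x. \<Sum>t\<leftarrow>trig_terms k. ?T x t)"
    by simp
  then show ?thesis
    by (rule continuous_on_cong[THEN iffD1, rotated 2])
       (use cube_coord[OF _ i] in \<open>auto simp: angular_deriv_def chain_deriv_def cos_arccos\<close>)
qed

lemma abs_angular_deriv_le:
  assumes "C_k_on_cube d k f" "i < d" "x \<in> cube d"
  shows "\<bar>angular_deriv i k f x\<bar> \<le> fact k * Ck_norm d k f"
  unfolding angular_deriv_def
  by (rule abs_chain_deriv_le) (intro abs_partial_deriv_le_Ck_norm cube_upd assms)

text \<open>
  By Fubini the coefficient is an iterated integral whose inner integral, over coordinate \<open>i\<close>, is a
  one-dimensional coefficient; there the integration by parts takes place. The sign does not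
  depend on the other coordinates and leaves the outer integral.\<close>

lemma power_mult_cheb_coeff:
  assumes f: "C_k_on_cube d k f" and i: "i < d"
  shows "real (K i) ^ k * cheb_coeff d f K = trig_sign k *
    (\<integral>x. angular_deriv i k f x * product_system d ((\<lambda>_. 0)(i := k)) K x \<partial>cheb_measure_d d)"
proof -
  interpret product_sigma_finite "\<lambda>_::nat. cheb_measure"
    by (rule product_sigma_finite_cheb)
  define I where "I = {..<d} - {i}"
  define R where "R = PiM I (\<lambda>_. cheb_measure)"
  define P where "P x = (\<Prod>l\<in>I. Tbar (K l) (x l))" for x :: "nat \<Rightarrow> real"
  have I: "finite I" "i \<notin> I" "insert i I = {..<d}"
    using i by (auto simp: I_def)
  have D: "cheb_measure_d d = PiM (insert i I) (\<lambda>_. cheb_measure)"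
    by (simp add: cheb_measure_d_def I)
  have upd: "x(i := t) \<in> cube d" if "x \<in> space R" "t \<in> {-1..1}" for x t
    using that i by (auto simp: R_def space_PiM cube_def I_def PiE_iff extensional_def)
  have split: "product_system d ((\<lambda>_. 0)(i := m)) K (x(i := t)) = P x * cheb_system m (K i) t" for m x t
  proof -
    have "product_system d ((\<lambda>_. 0)(i := m)) K (x(i := t))
        = cheb_system m (K i) t * (\<Prod>l\<in>I. cheb_system (((\<lambda>_. 0)(i := m)) l) (K l) ((x(i := t)) l))"
      unfolding product_system_def I(3)[symmetric] using I(1,2) by (subst prod.insert) auto
    also have "(\<Prod>l\<in>I. cheb_system (((\<lambda>_. 0)(i := m)) l) (K l) ((x(i := t)) l)) = P x"
      unfolding P_def using I(2) by (intro prod.cong) (auto simp: cheb_system_def)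
    finally show ?thesis by (simp only: mult.commute)
  qed
  have inner: "real (K i) ^ k * (\<integral>t. f (x(i := t)) * Tbar (K i) t \<partial>cheb_measure)
      = trig_sign k * (\<integral>t. angular_deriv i k f (x(i := t)) * cheb_system k (K i) t \<partial>cheb_measure)"
    if x: "x \<in> space R" for x
  proof -
    let ?H = "\<lambda>j t. (partial_deriv i ^^ j) f (x(i := t))"
    have "real (K i) ^ k * (\<integral>t. ?H 0 t * Tbar (K i) t \<partial>cheb_measure)
      = trig_sign k * (\<integral>t. chain_deriv ?H k (arccos t) * cheb_system k (K i) t \<partial>cheb_measure)"
    proof (rule power_mult_integral_Tbar)
      fix j t assume "j < k" "t \<in> {-1..1::real}"
      then show "(?H j has_real_derivative ?H (Suc j) t) (at t within {-1..1})"
        using C_k_has_partial_deriv[OF f i, of j "x(i := t)" t] upd[OF x] by simp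
    next
      fix j assume "j \<le> k"
      show "continuous_on {-1..1} (?H j)"
      proof (rule continuous_on_compose2[OF C_k_partial_deriv_continuous[OF f i \<open>j \<le> k\<close>]])
        show "continuous_on {-1..1} (\<lambda>t. x(i := t))"
          proof (rule continuous_on_coordinatewise_then_product)
            show "continuous_on {-1..1} (\<lambda>t. (x(i := t)) l)" for l
              by (cases "l = i") (auto intro!: continuous_intros)
          qed
      qed (use upd[OF x] in auto)
    qed
    then show ?thesis by (simp add: angular_deriv_def)
  qed
  have fubini: "(\<integral>x. F x * product_system d ((\<lambda>_. 0)(i := m)) K x \<partial>cheb_measure_d d)
      = (\<integral>x. P x * (\<integral>t. F (x(i := t)) * cheb_system m (K i) t \<partial>cheb_measure) \<partial>R)"
    if F: "continuous_on (cube d) F" for F m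
  proof -
    have "integrable (cheb_measure_d d) (\<lambda>x. F x * product_system d ((\<lambda>_. 0)(i := m)) K x)"
      by (intro integrable_continuous_on_cube continuous_on_mult F continuous_on_product_system)
    then have "(\<integral>x. F x * product_system d ((\<lambda>_. 0)(i := m)) K x \<partial>cheb_measure_d d)
        = (\<integral>x. (\<integral>t. F (x(i := t)) * product_system d ((\<lambda>_. 0)(i := m)) K (x(i := t)) \<partial>cheb_measure) \<partial>R)"
      unfolding D R_def by (rule product_integral_insert[OF I(1,2)])
    also have "\<dots> = (\<integral>x. (\<integral>t. P x * (F (x(i := t)) * cheb_system m (K i) t) \<partial>cheb_measure) \<partial>R)"
      by (simp only: split mult.left_commute)
    finally show ?thesis by simp
  qed
  \<comment> \<open>The void update \<open>i := 0\<close> brings the coefficient into the form of \<open>fubini\<close>.\<close>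
  have "cheb_coeff d f K = (\<integral>x. f x * product_system d ((\<lambda>_. 0)(i := 0)) K x \<partial>cheb_measure_d d)"
    by (simp add: cheb_coeff_def Tbar_multi_eq_product_system fun_upd_idem)
  also have "\<dots> = (\<integral>x. P x * (\<integral>t. f (x(i := t)) * Tbar (K i) t \<partial>cheb_measure) \<partial>R)"
    using fubini[OF C_k_imp_continuous[OF f], of 0] by (simp add: cheb_system_def)
  finally have "real (K i) ^ k * cheb_coeff d f K
      = (\<integral>x. P x * (real (K i) ^ k * (\<integral>t. f (x(i := t)) * Tbar (K i) t \<partial>cheb_measure)) \<partial>R)"
    by (simp only: mult.left_commute[of "P _"] integral_mult_right_zero)
  also have "\<dots> = (\<integral>x. P x * (trig_sign k *
      (\<integral>t. angular_deriv i k f (x(i := t)) * cheb_system k (K i) t \<partial>cheb_measure)) \<partial>R)"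
    by (intro Bochner_Integration.integral_cong refl) (simp only: inner)
  also have "\<dots> = trig_sign k *
      (\<integral>x. P x * (\<integral>t. angular_deriv i k f (x(i := t)) * cheb_system k (K i) t \<partial>cheb_measure) \<partial>R)"
    by (simp only: mult.left_commute[of "P _"] integral_mult_right_zero)
  also have "\<dots> = trig_sign k *
    (\<integral>x. angular_deriv i k f x * product_system d ((\<lambda>_. 0)(i := k)) K x \<partial>cheb_measure_d d)"
    by (simp only: fubini[OF continuous_on_angular_deriv[OF f i]])
  finally show ?thesis .
qed

text \<open>
  Bessel's inequality for the angular derivative: its expansion coefficients are
  \<open>K\<^sub>i\<^sup>k c\<^sub>K\<close> up to a common sign.\<close>

lemma sum_power_mult_cheb_coeff_le:
  assumes f: "C_k_on_cube d k f" and i: "i < d" and A: "finite A" "A \<subseteq> multi_indices d"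
  shows "(\<Sum>K\<in>A. (real (K i) ^ k * cheb_coeff d f K)\<^sup>2) \<le> (fact k * Ck_norm d k f)\<^sup>2"
proof -
  interpret prob_space "cheb_measure_d d" by (rule prob_space_cheb_measure_d)
  let ?F = "angular_deriv i k f"
  have F: "continuous_on (cube d) ?F"
    by (rule continuous_on_angular_deriv[OF f i])
  have "(trig_sign k)\<^sup>2 = 1"
    by (simp add: trig_sign_def flip: power_mult)
  then have "(\<Sum>K\<in>A. (real (K i) ^ k * cheb_coeff d f K)\<^sup>2)
      = (\<Sum>K\<in>A. (\<integral>x. ?F x * product_system d ((\<lambda>_. 0)(i := k)) K x \<partial>cheb_measure_d d)\<^sup>2)"
    by (simp add: power_mult_cheb_coeff[OF f i] power_mult_distrib)
  also have "\<dots> \<le> (\<integral>x. ?F x * ?F x \<partial>cheb_measure_d d)"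
    by (rule bessel_product_system[OF F A])
  also have "\<dots> \<le> (fact k * Ck_norm d k f)\<^sup>2"
  proof (rule integral_le_const)
    show "integrable (cheb_measure_d d) (\<lambda>x. ?F x * ?F x)"
      by (intro integrable_continuous_on_cube continuous_on_mult F)
    show "AE x in cheb_measure_d d. ?F x * ?F x \<le> (fact k * Ck_norm d k f)\<^sup>2"
    proof (rule AE_I2)
      fix x assume "x \<in> space (cheb_measure_d d)"
      then have "\<bar>?F x\<bar> \<le> fact k * Ck_norm d k f"
        using abs_angular_deriv_le[OF f i] by simp
      then have "\<bar>?F x\<bar>\<^sup>2 \<le> (fact k * Ck_norm d k f)\<^sup>2"
        by (rule power_mono) simp
      then show "?F x * ?F x \<le> (fact k * Ck_norm d k f)\<^sup>2"
        by (simp add: power2_eq_square)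
    qed
  qed
  finally show ?thesis .
qed

text \<open>
  The power mean inequality splits the weight \<open>\<parallel>K\<parallel>\<^sub>2\<^sup>2\<^sup>k\<close> into the pure weights \<open>K\<^sub>i\<^sup>2\<^sup>k\<close>, each of which
  is controlled by a derivative in a single angle.\<close>

lemma sum_weighted_cheb_coeff_le:
  assumes d: "d \<ge> 1" and f: "C_k_on_cube d k f" and A: "finite A" "A \<subseteq> multi_indices d"
  shows "(\<Sum>K\<in>A. L2_set (\<lambda>i. real (K i)) {..<d} ^ (2 * k) * (cheb_coeff d f K)\<^sup>2)
    \<le> real d ^ k * (fact k)\<^sup>2 * (Ck_norm d k f)\<^sup>2"
proof -
  have weight: "real d * L2_set (\<lambda>i. real (K i)) {..<d} ^ (2 * k)
      \<le> real d ^ k * (\<Sum>i<d. (real (K i) ^ k)\<^sup>2)" for K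
  proof -
    have "L2_set (\<lambda>i. real (K i)) {..<d} ^ (2 * k) = (\<Sum>i<d. (real (K i))\<^sup>2) ^ k"
      by (simp add: L2_set_def power_mult sum_nonneg)
    moreover have "real d * (\<Sum>i<d. (real (K i))\<^sup>2) ^ k \<le> real d ^ k * (\<Sum>i<d. ((real (K i))\<^sup>2) ^ k)"
      using power_mean_ineq[of "{..<d}" "\<lambda>i. (real (K i))\<^sup>2" k] d by (simp add: lessThan_empty_iff)
    ultimately show ?thesis
      by (simp add: mult.commute flip: power_mult)
  qed
  have "real d * (\<Sum>K\<in>A. L2_set (\<lambda>i. real (K i)) {..<d} ^ (2 * k) * (cheb_coeff d f K)\<^sup>2)
      = (\<Sum>K\<in>A. (real d * L2_set (\<lambda>i. real (K i)) {..<d} ^ (2 * k)) * (cheb_coeff d f K)\<^sup>2)"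
    by (simp add: sum_distrib_left mult.assoc)
  also have "\<dots> \<le> (\<Sum>K\<in>A. (real d ^ k * (\<Sum>i<d. (real (K i) ^ k)\<^sup>2)) * (cheb_coeff d f K)\<^sup>2)"
    by (intro sum_mono mult_right_mono weight) simp
  also have "\<dots> = real d ^ k * (\<Sum>i<d. \<Sum>K\<in>A. (real (K i) ^ k * cheb_coeff d f K)\<^sup>2)"
    by (subst sum.swap) (simp add: sum_distrib_left sum_distrib_right power_mult_distrib mult.assoc)
  also have "\<dots> \<le> real d ^ k * (\<Sum>i<d. (fact k * Ck_norm d k f)\<^sup>2)"
    by (intro mult_left_mono sum_mono sum_power_mult_cheb_coeff_le[OF f _ A]) auto
  also have "\<dots> = real d * (real d ^ k * (fact k)\<^sup>2 * (Ck_norm d k f)\<^sup>2)"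
    by (simp add: power_mult_distrib)
  finally show ?thesis
    using d by simp
qed

theorem theorem7:
  "\<exists>C :: nat \<Rightarrow> nat \<Rightarrow> real. \<forall>d\<ge>1. \<forall>k.
     C d k \<le> real d ^ k * exp (2 * real k) * (fact k)\<^sup>2 \<and>
     (\<forall>f :: (nat \<Rightarrow> real) \<Rightarrow> real. C_k_on_cube d k f \<longrightarrow>
        (\<lambda>K. L2_set (\<lambda>i. real (K i)) {..<d} ^ (2 * k) * (cheb_coeff d f K)\<^sup>2)
          summable_on multi_indices d \<and>
        (\<Sum>\<^sub>\<infinity>K\<in>multi_indices d.
            L2_set (\<lambda>i. real (K i)) {..<d} ^ (2 * k) * (cheb_coeff d f K)\<^sup>2)
          \<le> C d k * (Ck_norm d k f)\<^sup>2)"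
proof (rule exI[of _ "\<lambda>d k. real d ^ k * (fact k)\<^sup>2"], intro allI impI conjI)
  fix d k :: nat
  have "real d ^ k * 1 \<le> real d ^ k * exp (2 * real k)"
    by (intro mult_left_mono) auto
  then show "real d ^ k * (fact k)\<^sup>2 \<le> real d ^ k * exp (2 * real k) * (fact k)\<^sup>2"
    by (intro mult_right_mono) auto
next
  fix d k :: nat and f :: "(nat \<Rightarrow> real) \<Rightarrow> real"
  assume "d \<ge> 1" "C_k_on_cube d k f"
  note fin = sum_weighted_cheb_coeff_le[OF this]
  show summable: "(\<lambda>K. L2_set (\<lambda>i. real (K i)) {..<d} ^ (2 * k) * (cheb_coeff d f K)\<^sup>2)
      summable_on multi_indices d"
    using fin by (intro nonneg_bdd_above_summable_on bdd_aboveI) auto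
  show "(\<Sum>\<^sub>\<infinity>K\<in>multi_indices d. L2_set (\<lambda>i. real (K i)) {..<d} ^ (2 * k) * (cheb_coeff d f K)\<^sup>2)
      \<le> real d ^ k * (fact k)\<^sup>2 * (Ck_norm d k f)\<^sup>2"
    by (rule infsum_le_finite_sums[OF summable fin])
qed

end
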